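(* There exists a $\Pi^0_1$ equivalence structure $\mathcal{A}=\langle \omega, R\rangle$ which is not isomorphic to any $\Sigma^0_1$ equivalence structure. That is, $\operatorname{IsoType}(\mathbb{EQ}, \Pi^0_1) \not\subseteq \operatorname{IsoType}(\mathbb{EQ}, \Sigma^0_1)$.
   Context: An equivalence structure is a structure $\langle \omega, R\rangle$ where $R\subseteq\omega^2$ is an equivalence relation on $\omega$ (the domain is always $\omega$). For a complexity class $\Gamma$ (e.g. $\Sigma^0_1$, $\Pi^0_1$, $\Delta^0_2$), the structure $\langle\omega,R\rangle$ is called a $\Gamma$ equivalence structure if the relation $R$, viewed as a subset of $\omega^2$ (coded as a subset of $\omega$), belongs to $\Gamma$. The structures are considered directly (not as quotients). $\mathbb{EQ}$ denotes the class of countable equivalence structures, and $\operatorname{IsoType}(\mathbb{EQ},\Gamma)$ denotes the collection of isomorphism types realized by $\Gamma$ equivalence structures. *)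

theory Defs
  imports Main "HOL-Library.Nat_Bijection"
begin

text \<open>
  Kleene's partial recursive functions, presented as programs with a big-step semantics;
  \<open>rec_eval p xs v\<close> means that \<open>p\<close> halts on the argument tuple \<open>xs\<close> with value \<open>v\<close>.
  Arities are not recorded in the syntax: \<open>p\<close> denotes a \<open>k\<close>-ary partial function for every
  \<open>k\<close>, namely the restriction of its semantics to tuples of length \<open>k\<close> (undefined wherever
  the arities do not fit). In \<open>PrimRec\<close> and \<open>Mu\<close> the recursion variable, respectively the
  variable searched for, is the first argument.
\<close>

datatype recf =
    Zero
  | Succ
  | Proj nat
  | Comp recf "recf list"
  | PrimRec recf recf
  | Mu recf

inductive rec_eval :: "recf \<Rightarrow> nat list \<Rightarrow> nat \<Rightarrow> bool" where
  Zero: "rec_eval Zero xs 0"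
| Succ: "rec_eval Succ [x] (Suc x)"
| Proj: "i < length xs \<Longrightarrow> rec_eval (Proj i) xs (xs ! i)"
| Comp: "list_all2 (\<lambda>g y. rec_eval g xs y) gs ys \<Longrightarrow> rec_eval f ys z \<Longrightarrow>
    rec_eval (Comp f gs) xs z"
| PrimRec_0: "rec_eval f xs y \<Longrightarrow> rec_eval (PrimRec f g) (0 # xs) y"
| PrimRec_Suc: "rec_eval (PrimRec f g) (n # xs) y \<Longrightarrow> rec_eval g (n # y # xs) z \<Longrightarrow>
    rec_eval (PrimRec f g) (Suc n # xs) z"
| Mu: "rec_eval f (n # xs) 0 \<Longrightarrow> (\<forall>i<n. \<exists>y. rec_eval f (i # xs) (Suc y)) \<Longrightarrow>
    rec_eval (Mu f) xs n"

lemma rec_eval_deterministic: "rec_eval p xs v \<Longrightarrow> rec_eval p xs w \<Longrightarrow> v = w"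
proof (induction arbitrary: w rule: rec_eval.induct)
  case (Comp xs gs ys f z)
  from Comp.prems obtain ys' where ys': "list_all2 (\<lambda>g y. rec_eval g xs y) gs ys'"
    and f: "rec_eval f ys' w"
    by (cases rule: rec_eval.cases) auto
  have "ys = ys'"
    using Comp.IH(1) ys' by (auto simp: list_all2_conv_all_nth intro!: nth_equalityI)
  then show ?case using Comp.IH(2) f by simp
next
  case (Mu f n xs)
  from Mu.prems have w: "rec_eval f (w # xs) 0" "\<forall>i<w. \<exists>y. rec_eval f (i # xs) (Suc y)"
    by (cases rule: rec_eval.cases; simp)+
  show ?case
  proof (cases n w rule: linorder_cases)
    case less
    then show ?thesis using Mu.IH(1) w(2) by fastforce
  next
    case greater
    then show ?thesis using Mu.IH(2) w(1) by fastforce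
  qed
next
  case (PrimRec_Suc f g n xs y z)
  from PrimRec_Suc.prems show ?case
    by (cases rule: rec_eval.cases) (use PrimRec_Suc.IH in blast)
qed (erule rec_eval.cases; simp)+

text \<open>\<open>R\<close> is read as a \<open>k\<close>-ary relation on the natural numbers; computability means that
  its characteristic function is total recursive.\<close>

definition computable_rel :: "nat \<Rightarrow> nat list set \<Rightarrow> bool" where
  "computable_rel k R \<longleftrightarrow>
    (\<exists>p. \<forall>xs. length xs = k \<longrightarrow> rec_eval p xs (if xs \<in> R then 1 else 0))"

definition Sigma01 :: "nat set set" where
  "Sigma01 = {A. \<exists>R. computable_rel 2 R \<and> A = {x. \<exists>y. [x, y] \<in> R}}"

definition Pi01 :: "nat set set" where
  "Pi01 = {A. \<exists>R. computable_rel 2 R \<and> A = {x. \<forall>y. [x, y] \<in> R}}"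

text \<open>An equivalence structure is identified with its relation, the domain being all of
  \<open>nat\<close>; pairs are coded by the Cantor pairing function.\<close>

definition EQ :: "(nat \<times> nat) set set" where
  "EQ = {R. equiv UNIV R}"

definition EQ_in :: "nat set set \<Rightarrow> (nat \<times> nat) set set" where
  "EQ_in \<Gamma> = {R \<in> EQ. prod_encode ` R \<in> \<Gamma>}"

definition isomorphic :: "(nat \<times> nat) set \<Rightarrow> (nat \<times> nat) set \<Rightarrow> bool" where
  "isomorphic R S \<longleftrightarrow> (\<exists>f. bij f \<and> (\<forall>x y. (x, y) \<in> R \<longleftrightarrow> (f x, f y) \<in> S))"

definition iso_type :: "(nat \<times> nat) set \<Rightarrow> (nat \<times> nat) set set" where
  "iso_type R = {S \<in> EQ. isomorphic R S}"

definition IsoType :: "nat set set \<Rightarrow> (nat \<times> nat) set set set" where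
  "IsoType \<Gamma> = iso_type ` EQ_in \<Gamma>"

end

theory Submission
  imports Defs
begin

text \<open>Let \<open>W\<^sub>k\<close> be the \<open>k\<close>-th \<open>\<Sigma>\<^sup>0\<^sub>1\<close> binary relation. The condition ``no class of \<open>W\<^sub>k\<close> has
  exactly \<open>k + 2\<close> elements'' is \<open>\<Pi>\<^sup>0\<^sub>2\<close>: whenever a class is seen to reach size \<open>k + 2\<close>, it is
  later seen to reach \<open>k + 3\<close>. A \<open>\<Pi>\<^sup>0\<^sub>1\<close> relation can encode such a condition by a class that
  starts infinite and loses one element, as a singleton, each time the condition is confirmed
  once more: the class ends up with exactly \<open>k + 2\<close> elements if the condition holds, and stays
  infinite otherwise. Doing this for all \<open>k\<close> yields a relation that has a class of size
  \<open>k + 2\<close> iff \<open>W\<^sub>k\<close> has none.\<close>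

section \<open>Total recursive functions of one argument\<close>

text \<open>Environments with several variables are coded by iterated pairing, so that the closure
  properties below need no arities: a binder pushes its variable onto the environment.\<close>

definition pfst :: "nat \<Rightarrow> nat" where
  "pfst e = fst (prod_decode e)"

definition psnd :: "nat \<Rightarrow> nat" where
  "psnd e = snd (prod_decode e)"

lemma pfst_prod_encode [simp]: "pfst (prod_encode (a, b)) = a"
  by (simp add: pfst_def)

lemma psnd_prod_encode [simp]: "psnd (prod_encode (a, b)) = b"
  by (simp add: psnd_def)

lemma prod_encode_pfst_psnd [simp]: "prod_encode (pfst e, psnd e) = e"
  by (simp add: pfst_def psnd_def)

definition recursive :: "(nat \<Rightarrow> nat) \<Rightarrow> bool" where
  "recursive f \<longleftrightarrow> (\<exists>p. \<forall>x. rec_eval p [x] (f x))"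

definition decidable :: "(nat \<Rightarrow> bool) \<Rightarrow> bool" where
  "decidable P \<longleftrightarrow> recursive (\<lambda>x. of_bool (P x))"

lemma rec_eval_Comp1:
  "rec_eval g xs a \<Longrightarrow> rec_eval f [a] z \<Longrightarrow> rec_eval (Comp f [g]) xs z"
  by (rule rec_eval.Comp[where ys = "[a]"]) auto

lemma rec_eval_Comp2:
  "rec_eval g xs a \<Longrightarrow> rec_eval h xs b \<Longrightarrow> rec_eval f [a, b] z \<Longrightarrow>
    rec_eval (Comp f [g, h]) xs z"
  by (rule rec_eval.Comp[where ys = "[a, b]"]) auto

lemma rec_eval_Proj0: "rec_eval (Proj 0) (x # xs) x"
  using rec_eval.Proj[of 0 "x # xs"] by simp

lemma rec_eval_Proj1: "rec_eval (Proj (Suc 0)) (x # y # xs) y"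
  using rec_eval.Proj[of "Suc 0" "x # y # xs"] by simp

lemma rec_eval_Proj2: "rec_eval (Proj 2) (x # y # z # xs) z"
  using rec_eval.Proj[of 2 "x # y # z # xs"] by simp

lemmas rec_eval_basic = rec_eval_Comp1 rec_eval_Comp2 rec_eval_Proj0 rec_eval_Proj1
  rec_eval_Proj2 rec_eval.Zero rec_eval.Succ

section \<open>Programs for arithmetic and for the Cantor pairing and its inverses\<close>

definition add_prog :: recf where
  "add_prog = PrimRec (Proj 0) (Comp Succ [Proj (Suc 0)])"

lemma rec_eval_add: "rec_eval add_prog [m, n] (m + n)"
  unfolding add_prog_def
  by (induction m) (auto intro: rec_eval_basic rec_eval.PrimRec_0 rec_eval.PrimRec_Suc)

definition pred_prog :: recf where
  "pred_prog = PrimRec Zero (Proj 0)"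

lemma rec_eval_pred: "rec_eval pred_prog [n] (n - 1)"
  unfolding pred_prog_def
  by (induction n) (auto intro: rec_eval_basic rec_eval.PrimRec_0 rec_eval.PrimRec_Suc)

text \<open>Recursion runs on the first argument, here the subtrahend; the outer \<open>Comp\<close>
  restores the usual order.\<close>

definition monus_prog :: recf where
  "monus_prog = Comp (PrimRec (Proj 0) (Comp pred_prog [Proj (Suc 0)])) [Proj (Suc 0), Proj 0]"

lemma rec_eval_monus: "rec_eval monus_prog [m, n] (m - n)"
proof -
  have "rec_eval (PrimRec (Proj 0) (Comp pred_prog [Proj (Suc 0)])) [n, m] (m - n)"
  proof (induction n)
    case (Suc n)
    have "rec_eval (Comp pred_prog [Proj (Suc 0)]) [n, m - n, m] (m - n - 1)"
      by (rule rec_eval_Comp1[OF rec_eval_Proj1 rec_eval_pred])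
    then show ?case using rec_eval.PrimRec_Suc[OF Suc] by simp
  qed (auto intro: rec_eval_basic rec_eval.PrimRec_0)
  then show ?thesis
    unfolding monus_prog_def by (rule rec_eval_Comp2[OF rec_eval_Proj1 rec_eval_Proj0])
qed

definition triangle_prog :: recf where
  "triangle_prog = PrimRec Zero (Comp add_prog [Proj (Suc 0), Comp Succ [Proj 0]])"

lemma rec_eval_triangle: "rec_eval triangle_prog [n] (triangle n)"
proof (induction n)
  case 0
  show ?case
    unfolding triangle_prog_def by (auto intro: rec_eval_basic rec_eval.PrimRec_0)
next
  case (Suc n)
  have "rec_eval (Comp add_prog [Proj (Suc 0), Comp Succ [Proj 0]]) [n, triangle n]
      (triangle n + Suc n)"
    by (rule rec_eval_Comp2[OF rec_eval_Proj1 _ rec_eval_add])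
      (rule rec_eval_Comp1[OF rec_eval_Proj0 rec_eval.Succ])
  then show ?case
    using rec_eval.PrimRec_Suc Suc unfolding triangle_prog_def by simp
qed

definition pair_prog :: recf where
  "pair_prog = Comp add_prog [Comp triangle_prog [add_prog], Proj 0]"

lemma rec_eval_pair: "rec_eval pair_prog [m, n] (prod_encode (m, n))"
  unfolding pair_prog_def prod_encode_def prod.case
  by (rule rec_eval_Comp2[OF rec_eval_Comp1[OF rec_eval_add rec_eval_triangle]
        rec_eval_Proj0 rec_eval_add])

text \<open>Searches for the least \<open>t\<close> with \<open>e < triangle (Suc t)\<close>, the
  condition under which the truncated difference vanishes. As
  \<open>prod_encode (a, b) = triangle (a + b) + a\<close>, this \<open>t\<close> is the
  antidiagonal \<open>a + b\<close>.\<close>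

definition diag_prog :: recf where
  "diag_prog = Mu (Comp monus_prog [Comp Succ [Proj (Suc 0)],
    Comp triangle_prog [Comp Succ [Proj 0]]])"

lemma mono_triangle: "i \<le> j \<Longrightarrow> triangle i \<le> triangle j"
  by (induction j rule: dec_induct) simp_all

lemma rec_eval_diag: "rec_eval diag_prog [prod_encode (a, b)] (a + b)"
proof -
  let ?e = "prod_encode (a, b)"
  let ?f = "Comp monus_prog [Comp Succ [Proj (Suc 0)], Comp triangle_prog [Comp Succ [Proj 0]]]"
  have f: "rec_eval ?f [t, ?e] (Suc ?e - triangle (Suc t))" for t
    by (intro rec_eval_Comp2[OF _ _ rec_eval_monus] rec_eval_Comp1[OF rec_eval_Proj1]
        rec_eval_Comp1[OF rec_eval_Comp1[OF rec_eval_Proj0] rec_eval_triangle] rec_eval.Succ)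
  have "rec_eval ?f [a + b, ?e] 0"
    using f[of "a + b"] by (simp add: prod_encode_def)
  moreover have "\<exists>y. rec_eval ?f [t, ?e] (Suc y)" if "t < a + b" for t
  proof -
    have "triangle (Suc t) \<le> ?e"
      using mono_triangle[of "Suc t" "a + b"] that by (simp add: prod_encode_def)
    then have "Suc ?e - triangle (Suc t) = Suc (?e - triangle (Suc t))"
      by simp
    then show ?thesis using f[of t] by metis
  qed
  ultimately show ?thesis
    unfolding diag_prog_def by (intro rec_eval.Mu) auto
qed

definition pfst_prog :: recf where
  "pfst_prog = Comp monus_prog [Proj 0, Comp triangle_prog [diag_prog]]"

definition psnd_prog :: recf where
  "psnd_prog = Comp monus_prog [diag_prog, pfst_prog]"

lemma rec_eval_pfst: "rec_eval pfst_prog [e] (pfst e)"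
proof -
  obtain a b where e: "e = prod_encode (a, b)"
    using prod_encode_pfst_psnd by metis
  have "rec_eval pfst_prog [e] (e - triangle (a + b))"
    unfolding pfst_prog_def e
    by (rule rec_eval_Comp2[OF rec_eval_Proj0
          rec_eval_Comp1[OF rec_eval_diag rec_eval_triangle] rec_eval_monus])
  then show ?thesis by (simp add: e) (simp add: prod_encode_def)
qed

lemma rec_eval_psnd: "rec_eval psnd_prog [e] (psnd e)"
proof -
  obtain a b where e: "e = prod_encode (a, b)"
    using prod_encode_pfst_psnd by metis
  have "rec_eval psnd_prog [e] (a + b - pfst e)"
    unfolding psnd_prog_def using rec_eval_pfst[of e] unfolding e
    by (rule rec_eval_Comp2[OF rec_eval_diag _ rec_eval_monus])
  then show ?thesis by (simp add: e)
qed

section \<open>Closure properties of recursive functions\<close>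

lemma recursive_apply1:
  assumes "\<And>x. rec_eval p [x] (g x)" "recursive f"
  shows "recursive (\<lambda>x. g (f x))"
  using assms unfolding recursive_def by (meson rec_eval_Comp1)

lemma recursive_apply2:
  assumes "\<And>x y. rec_eval p [x, y] (h x y)" "recursive f" "recursive g"
  shows "recursive (\<lambda>x. h (f x) (g x))"
  using assms unfolding recursive_def by (meson rec_eval_Comp2)

lemma recursive_compose: "recursive g \<Longrightarrow> recursive f \<Longrightarrow> recursive (\<lambda>x. g (f x))"
  unfolding recursive_def by (meson rec_eval_Comp1)

lemma recursive_id: "recursive (\<lambda>x. x)"
  unfolding recursive_def using rec_eval_Proj0 by blast

lemma recursive_Suc: "recursive f \<Longrightarrow> recursive (\<lambda>x. Suc (f x))"
  by (rule recursive_apply1[OF rec_eval.Succ])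

lemma recursive_const: "recursive (\<lambda>x. c)"
proof (induction c)
  case 0
  show ?case unfolding recursive_def using rec_eval.Zero by blast
qed (rule recursive_Suc)

lemmas recursive_add = recursive_apply2[OF rec_eval_add]
lemmas recursive_diff = recursive_apply2[OF rec_eval_monus]
lemmas recursive_pair = recursive_apply2[OF rec_eval_pair]
lemmas recursive_pfst = recursive_apply1[OF rec_eval_pfst]
lemmas recursive_psnd = recursive_apply1[OF rec_eval_psnd]

text \<open>A program \<open>PrimRec pa ?g\<close> does the recursion with \<open>x\<close> as
  parameter; \<open>?g\<close> packs counter, accumulator and \<open>x\<close> into the nested pair
  on which \<open>F\<close> is assumed recursive.\<close>

lemma recursive_rec_nat:
  assumes "recursive a" "recursive b" "recursive (\<lambda>e. F (pfst e) (pfst (psnd e)) (psnd (psnd e)))"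
  shows "recursive (\<lambda>x. rec_nat (a x) (\<lambda>n y. F n y x) (b x))"
proof -
  obtain pa pb pF where pa: "\<And>x. rec_eval pa [x] (a x)"
    and pb: "\<And>x. rec_eval pb [x] (b x)"
    and pF: "\<And>e. rec_eval pF [e] (F (pfst e) (pfst (psnd e)) (psnd (psnd e)))"
    using assms unfolding recursive_def by blast
  let ?g = "Comp pF [Comp pair_prog [Proj 0, Comp pair_prog [Proj (Suc 0), Proj 2]]]"
  have g: "rec_eval ?g [n, y, x] (F n y x)" for n y x
    by (rule rec_eval_Comp1[where a = "prod_encode (n, prod_encode (y, x))"])
      (use pF[of "prod_encode (n, prod_encode (y, x))"] in
        \<open>auto intro: rec_eval_basic rec_eval_pair\<close>)
  have "rec_eval (PrimRec pa ?g) [k, x] (rec_nat (a x) (\<lambda>n y. F n y x) k)" for k x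
    by (induction k) (auto intro: rec_eval.PrimRec_0 rec_eval.PrimRec_Suc pa g)
  then have "rec_eval (Comp (PrimRec pa ?g) [pb, Proj 0]) [x]
      (rec_nat (a x) (\<lambda>n y. F n y x) (b x))" for x
    by (rule rec_eval_Comp2[OF pb rec_eval_Proj0])
  then show ?thesis unfolding recursive_def by blast
qed

lemmas recursive_basic = recursive_id recursive_const recursive_Suc recursive_add recursive_diff recursive_pair recursive_pfst
  recursive_psnd

lemma recursive_sum:
  assumes "recursive b" "recursive (\<lambda>e. F (pfst e) (psnd e))"
  shows "recursive (\<lambda>x. \<Sum>i<b x. F i x)"
proof -
  \<comment> \<open>The environment of the recursion also holds the accumulator, which the summand
    has to skip.\<close>
  have "recursive (\<lambda>e. F (pfst e) (psnd (psnd e)))"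
    using recursive_compose[OF assms(2), of "\<lambda>e. prod_encode (pfst e, psnd (psnd e))"]
    by (simp add: recursive_basic)
  then have "recursive (\<lambda>x. rec_nat 0 (\<lambda>n y. y + F n x) (b x))"
    by (intro recursive_rec_nat recursive_basic assms)
  moreover have "rec_nat 0 (\<lambda>n y. y + F n x) k = (\<Sum>i<k. F i x)" for k x
    by (induction k) auto
  ultimately show ?thesis by simp
qed

lemma recursive_mult:
  assumes "recursive f" "recursive g"
  shows "recursive (\<lambda>x. f x * g x)"
proof -
  have "recursive (\<lambda>x. \<Sum>i<f x. g x)"
    by (intro recursive_sum recursive_compose[OF assms(2)] recursive_basic assms)
  then show ?thesis by simp
qed

lemma recursive_power:
  assumes "recursive f" "recursive g"
  shows "recursive (\<lambda>x. f x ^ g x)"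
proof -
  have "recursive (\<lambda>x. rec_nat 1 (\<lambda>n y. f x * y) (g x))"
    by (intro recursive_rec_nat recursive_mult recursive_compose[OF assms(1)] recursive_basic assms)
  moreover have "rec_nat 1 (\<lambda>n y. f x * y) k = f x ^ k" for k x
    by (induction k) auto
  ultimately show ?thesis by simp
qed

section \<open>Decidable predicates and bounded quantifiers\<close>

lemma decidable_not: "decidable P \<Longrightarrow> decidable (\<lambda>x. \<not> P x)"
proof -
  assume "decidable P"
  then have "recursive (\<lambda>x. 1 - of_bool (P x))"
    unfolding decidable_def by (intro recursive_diff recursive_const)
  moreover have "1 - of_bool (P x) = (of_bool (\<not> P x) :: nat)" for x
    by simp
  ultimately show "decidable (\<lambda>x. \<not> P x)"
    unfolding decidable_def by simp
qed

lemma decidable_conj: "decidable P \<Longrightarrow> decidable Q \<Longrightarrow> decidable (\<lambda>x. P x \<and> Q x)"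
  unfolding decidable_def of_bool_conj by (rule recursive_mult)

lemma decidable_disj: "decidable P \<Longrightarrow> decidable Q \<Longrightarrow> decidable (\<lambda>x. P x \<or> Q x)"
  using decidable_not[OF decidable_conj[OF decidable_not decidable_not]] by simp

lemma decidable_imp: "decidable P \<Longrightarrow> decidable Q \<Longrightarrow> decidable (\<lambda>x. P x \<longrightarrow> Q x)"
  using decidable_disj[OF decidable_not] by simp

lemma decidable_le:
  assumes "recursive f" "recursive g"
  shows "decidable (\<lambda>x. f x \<le> g x)"
proof -
  have "(of_bool (f x \<le> g x) :: nat) = 1 - (f x - g x)" for x
    by auto
  then show ?thesis
    unfolding decidable_def using assms by (simp add: recursive_basic)
qed

lemma decidable_less: "recursive f \<Longrightarrow> recursive g \<Longrightarrow> decidable (\<lambda>x. f x < g x)"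
  using decidable_not[OF decidable_le] by (simp add: not_le)

lemma decidable_eq: "recursive f \<Longrightarrow> recursive g \<Longrightarrow> decidable (\<lambda>x. f x = g x)"
  unfolding eq_iff by (intro decidable_conj decidable_le)

lemma decidable_bex:
  assumes "recursive b" "decidable (\<lambda>e. P (pfst e) (psnd e))"
  shows "decidable (\<lambda>x. \<exists>i<b x. P i x)"
proof -
  have "recursive (\<lambda>x. \<Sum>i<b x. of_bool (P i x))"
    using assms unfolding decidable_def by (intro recursive_sum)
  then have "decidable (\<lambda>x. 0 < (\<Sum>i<b x. of_bool (P i x) :: nat))"
    by (intro decidable_less recursive_const)
  moreover have "0 < (\<Sum>i<b x. of_bool (P i x) :: nat) \<longleftrightarrow> (\<exists>i<b x. P i x)" for x
    by (auto simp: card_gt_0_iff)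
  ultimately show ?thesis by simp
qed

lemma decidable_ball:
  assumes "recursive b" "decidable (\<lambda>e. P (pfst e) (psnd e))"
  shows "decidable (\<lambda>x. \<forall>i<b x. P i x)"
  using decidable_not[OF decidable_bex[OF assms(1) decidable_not[OF assms(2)]]] by simp

lemma recursive_if:
  assumes "decidable P" "recursive f" "recursive g"
  shows "recursive (\<lambda>x. if P x then f x else g x)"
proof -
  have "recursive (\<lambda>x. of_bool (P x) * f x + (1 - of_bool (P x)) * g x)"
    using assms unfolding decidable_def by (intro recursive_add recursive_mult recursive_diff recursive_const)
  moreover have "of_bool (P x) * f x + (1 - of_bool (P x)) * g x =
      (if P x then f x else g x)" for x
    by simp
  ultimately show ?thesis by simp
qed

text \<open>Bit \<open>i\<close> of \<open>d\<close> is set iff \<open>d div 2 ^ i\<close> is odd.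
  Writing this quotient as \<open>2 * q + 1\<close> and bounding \<open>q\<close> by
  \<open>d\<close> replaces division by a bounded search.\<close>

lemma decidable_set_decode:
  assumes "recursive f" "recursive g"
  shows "decidable (\<lambda>x. f x \<in> set_decode (g x))"
proof -
  have eq: "i \<in> set_decode d \<longleftrightarrow> (\<exists>q<Suc d. (2 * q + 1) * 2 ^ i \<le> d \<and> d < (2 * q + 2) * 2 ^ i)"
    (is "_ \<longleftrightarrow> ?R") for i d :: nat
  proof
    assume "i \<in> set_decode d"
    then obtain q where q: "d div 2 ^ i = 2 * q + 1"
      by (auto simp: set_decode_def elim: oddE)
    then have "(2 * q + 1) * 2 ^ i \<le> d" "d < (2 * q + 2) * 2 ^ i"
      using div_times_less_eq_dividend[of d "2 ^ i"] dividend_less_div_times[of "2 ^ i" d]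
      by (auto simp: algebra_simps)
    moreover have "q < Suc d"
      using q div_le_dividend[of d "2 ^ i"] by linarith
    ultimately show ?R by blast
  next
    assume ?R
    then obtain q where "(2 * q + 1) * 2 ^ i \<le> d" "d < Suc (2 * q + 1) * 2 ^ i"
      by auto
    then have "d div 2 ^ i = 2 * q + 1"
      by (intro div_nat_eqI) (simp_all add: algebra_simps)
    then show "i \<in> set_decode d" by (simp add: set_decode_def)
  qed
  show ?thesis
    unfolding eq
    by (intro decidable_bex decidable_conj decidable_le decidable_less recursive_mult recursive_power recursive_basic
        recursive_compose[OF assms(1)] recursive_compose[OF assms(2)])
qed

lemmas recursive_intros = recursive_basic recursive_mult recursive_power recursive_sum recursive_rec_nat recursive_if
  decidable_not decidable_conj decidable_disj decidable_imp decidable_le decidable_less decidable_eq decidable_bex decidable_ball decidable_set_decode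

lemma computable_rel_decidable:
  assumes "decidable (\<lambda>e. [pfst e, psnd e] \<in> R)"
  shows "computable_rel 2 R"
proof -
  obtain p where p: "\<And>e. rec_eval p [e] (of_bool ([pfst e, psnd e] \<in> R))"
    using assms unfolding decidable_def recursive_def by blast
  have "rec_eval (Comp p [pair_prog]) xs (if xs \<in> R then 1 else 0)" if "length xs = 2" for xs
  proof -
    from that obtain x y where xs: "xs = [x, y]"
      by (auto simp: length_Suc_conv numeral_2_eq_2)
    show ?thesis
      using rec_eval_Comp1[OF rec_eval_pair p, of x y] by (simp add: xs of_bool_def)
  qed
  then show ?thesis
    unfolding computable_rel_def by blast
qed

section \<open>Inductive closure under computable rules\<close>

text \<open>The uniform rule shape names every instance by a rule index and one number
  \<open>w\<close>, so that the instances can be tried one after another. The seed 0 serves as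
  premise of axioms.\<close>

inductive_set closure ::
    "((nat \<Rightarrow> nat) \<times> (nat \<Rightarrow> nat) \<times> (nat \<Rightarrow> nat)) list \<Rightarrow> nat set" for rs where
  zero: "0 \<in> closure rs"
| step: "(p, q, c) \<in> set rs \<Longrightarrow> p w \<in> closure rs \<Longrightarrow> q w \<in> closure rs \<Longrightarrow>
    c w \<in> closure rs"

text \<open>The default 0 for an index out of range is harmless, since 0 lies in every
  closure.\<close>

fun select :: "(nat \<Rightarrow> nat) list \<Rightarrow> nat \<Rightarrow> nat \<Rightarrow> nat" where
  "select [] r w = 0"
| "select (f # fs) r w = (if r = 0 then f w else select fs (r - 1) w)"

lemma select_nth: "select fs r w = (if r < length fs then (fs ! r) w else 0)"
  by (induction fs arbitrary: r) (auto simp: nth_Cons')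

lemma recursive_select:
  assumes "\<forall>f\<in>set fs. recursive f" "recursive a" "recursive b"
  shows "recursive (\<lambda>x. select fs (a x) (b x))"
  using assms
proof (induction fs arbitrary: a)
  case (Cons f fs)
  have "recursive (\<lambda>x. select fs (a x - 1) (b x))"
    by (rule Cons.IH) (use Cons.prems in \<open>auto intro: recursive_intros\<close>)
  then show ?case
    using Cons.prems by (auto intro!: recursive_intros intro: recursive_compose[of f])
qed (simp add: recursive_const)

text \<open>Stage \<open>n\<close> tries the rule instance coded by \<open>pfst n\<close>; hence every
  instance is tried infinitely often.\<close>

definition closure_step ::
    "((nat \<Rightarrow> nat) \<times> (nat \<Rightarrow> nat) \<times> (nat \<Rightarrow> nat)) list \<Rightarrow> nat \<Rightarrow> nat \<Rightarrow> nat" where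
  "closure_step rs n d =
    (let sel = (\<lambda>\<pi>. select (map \<pi> rs) (pfst (pfst n)) (psnd (pfst n)));
         c = sel (snd \<circ> snd)
     in if sel fst \<in> set_decode d \<and> sel (fst \<circ> snd) \<in> set_decode d \<and> c \<notin> set_decode d
        then 2 ^ c + d else d)"

text \<open>Finite sets are coded by binary expansions; the initial value 1 codes
  \<open>{0}\<close>.\<close>

definition stage ::
    "((nat \<Rightarrow> nat) \<times> (nat \<Rightarrow> nat) \<times> (nat \<Rightarrow> nat)) list \<Rightarrow> nat \<Rightarrow> nat" where
  "stage rs n = rec_nat 1 (closure_step rs) n"

lemma set_decode_closure_step:
  "set_decode (closure_step rs n d) =
    (if select (map fst rs) (pfst (pfst n)) (psnd (pfst n)) \<in> set_decode d \<and>
        select (map (fst \<circ> snd) rs) (pfst (pfst n)) (psnd (pfst n)) \<in> set_decode d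
     then insert (select (map (snd \<circ> snd) rs) (pfst (pfst n)) (psnd (pfst n))) (set_decode d)
     else set_decode d)"
  unfolding closure_step_def Let_def by (auto simp: set_decode_plus_power_2)

lemma recursive_stage:
  assumes "\<And>p q c. (p, q, c) \<in> set rs \<Longrightarrow> recursive p \<and> recursive q \<and> recursive c" and "recursive f"
  shows "recursive (\<lambda>x. stage rs (f x))"
proof -
  have sel: "\<forall>f\<in>set (map \<pi> rs). recursive f" if "\<pi> \<in> {fst, fst \<circ> snd, snd \<circ> snd}" for \<pi>
    using that assms(1) by fastforce
  show ?thesis
    unfolding stage_def closure_step_def Let_def
    by (intro recursive_intros recursive_select sel assms(2)) simp_all
qed

lemma stage_mono: "m \<le> n \<Longrightarrow> set_decode (stage rs m) \<subseteq> set_decode (stage rs n)"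
proof (induction n rule: dec_induct)
  case (step n)
  have "set_decode (stage rs n) \<subseteq> set_decode (stage rs (Suc n))"
    unfolding stage_def by (auto simp: set_decode_closure_step)
  with step.IH show ?case by simp
qed simp

lemma set_decode_stage_0: "set_decode (stage rs 0) = {0}"
  using set_encode_inverse[of "{0}"] by (simp add: stage_def set_encode_def)

lemma closure_iff_stage: "x \<in> closure rs \<longleftrightarrow> (\<exists>n. x \<in> set_decode (stage rs n))"
proof
  assume "x \<in> closure rs"
  then show "\<exists>n. x \<in> set_decode (stage rs n)"
  proof induction
    case zero
    show ?case using set_decode_stage_0[of rs] by blast
  next
    case (step p q c w)
    from step.hyps(1) obtain r where r: "r < length rs" "rs ! r = (p, q, c)"
      by (meson in_set_conv_nth)
    from step.IH obtain m1 m2 where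
      m: "p w \<in> set_decode (stage rs m1)" "q w \<in> set_decode (stage rs m2)"
      by blast
    \<comment> \<open>A stage that tries instance \<open>(r, w)\<close> and, since a pair code
      bounds its second component, comes after both premises have appeared.\<close>
    define n where "n = prod_encode (prod_encode (r, w), max m1 m2)"
    have "max m1 m2 \<le> n"
      by (simp only: n_def le_prod_encode_2)
    then have "m1 \<le> n" "m2 \<le> n" by simp_all
    then have "p w \<in> set_decode (stage rs n)" "q w \<in> set_decode (stage rs n)"
      using m stage_mono by blast+
    then have "c w \<in> set_decode (stage rs (Suc n))"
      using r by (simp add: stage_def set_decode_closure_step select_nth n_def)
    then show ?case by blast
  qed
next
  assume "\<exists>n. x \<in> set_decode (stage rs n)"
  then obtain n where "x \<in> set_decode (stage rs n)" by blast
  then show "x \<in> closure rs"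
  proof (induction n arbitrary: x)
    case 0
    then show ?case by (simp add: set_decode_stage_0 closure.zero)
  next
    case (Suc n)
    define r w where rw: "r = pfst (pfst n)" "w = psnd (pfst n)"
    show ?case
    proof (cases "x \<in> set_decode (stage rs n)")
      case False
      with Suc.prems have x: "x = select (map (snd \<circ> snd) rs) r w"
        and "select (map fst rs) r w \<in> set_decode (stage rs n)"
        and "select (map (fst \<circ> snd) rs) r w \<in> set_decode (stage rs n)"
        by (auto simp: stage_def set_decode_closure_step rw split: if_splits)
      then have "select (map fst rs) r w \<in> closure rs"
        and "select (map (fst \<circ> snd) rs) r w \<in> closure rs"
        using Suc.IH by blast+
      \<comment> \<open>If \<open>r\<close> is no rule index, then \<open>x\<close> is the default
        0.\<close>
      then show ?thesis
        using closure.step[of "fst (rs ! r)" "fst (snd (rs ! r))" "snd (snd (rs ! r))" rs w]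
        by (auto simp: x select_nth closure.zero)
    qed (use Suc.IH in simp)
  qed
qed

section \<open>Evaluation as an inductive closure\<close>

primrec code :: "recf \<Rightarrow> nat" where
  "code Zero = prod_encode (0, 0)"
| "code Succ = prod_encode (1, 0)"
| "code (Proj i) = prod_encode (2, i)"
| "code (Comp f gs) = prod_encode (3, prod_encode (code f, list_encode (map code gs)))"
| "code (PrimRec f g) = prod_encode (4, prod_encode (code f, code g))"
| "code (Mu f) = prod_encode (5, code f)"

lemma code_eq_iff:
  "code p = prod_encode (0, x) \<longleftrightarrow> p = Zero \<and> x = 0"
  "code p = prod_encode (Suc 0, x) \<longleftrightarrow> p = Succ \<and> x = 0"
  "code p = prod_encode (2, x) \<longleftrightarrow> p = Proj x"
  "code p = prod_encode (3, prod_encode (x, y)) \<longleftrightarrow>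
    (\<exists>f gs. p = Comp f gs \<and> x = code f \<and> y = list_encode (map code gs))"
  "code p = prod_encode (4, x) \<longleftrightarrow>
    (\<exists>f g. p = PrimRec f g \<and> x = prod_encode (code f, code g))"
  "code p = prod_encode (5, x) \<longleftrightarrow> (\<exists>f. p = Mu f \<and> x = code f)"
  by (cases p; auto)+

text \<open>The clause of \<open>list_encode\<close> for nonempty lists as an operation on codes, so
  that rules can build tuples arithmetically.\<close>

definition cons_code :: "nat \<Rightarrow> nat \<Rightarrow> nat" where
  "cons_code x l = Suc (prod_encode (x, l))"

lemma list_decode_cons_code [simp]: "list_decode (cons_code x l) = x # list_decode l"
  by (simp add: cons_code_def)

lemma list_encode_Cons: "list_encode (x # xs) = cons_code x (list_encode xs)"
  by (simp add: cons_code_def)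

lemma list_encode_eq_cons_code:
  "list_encode xs = cons_code y l \<longleftrightarrow> (\<exists>ys. xs = y # ys \<and> list_encode ys = l)"
  by (cases xs) (auto simp: cons_code_def)

lemma list_encode_eq_0: "list_encode xs = 0 \<longleftrightarrow> xs = []"
  by (cases xs) auto

text \<open>Judgements. Kind 0: program \<open>a\<close> maps the tuple \<open>b\<close> to \<open>c\<close>. Kind 1: the list \<open>a\<close> of
  programs maps the tuple \<open>b\<close> to the tuple \<open>c\<close>. Kind 2: \<open>a\<close> is positive on \<open>i # c\<close> for all
  \<open>i < b\<close>. Kind 3: entry \<open>a\<close> of the list \<open>b\<close> is \<open>c\<close>. The code \<open>0\<close> is reserved for the
  trivially derivable judgement, which pads rules with fewer than two premises.\<close>

definition judge :: "nat \<Rightarrow> nat \<Rightarrow> nat \<Rightarrow> nat \<Rightarrow> nat" where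
  "judge t a b c = Suc (prod_encode (t, prod_encode (a, prod_encode (b, c))))"

lemma judge_eq_iff [simp]:
  "judge t a b c = judge t' a' b' c' \<longleftrightarrow> t = t' \<and> a = a' \<and> b = b' \<and> c = c'"
  by (simp add: judge_def)

lemma judge_neq_0 [simp]: "judge t a b c \<noteq> 0" "0 \<noteq> judge t a b c"
  by (simp_all add: judge_def)

lemma recursive_judge:
  "recursive t \<Longrightarrow> recursive a \<Longrightarrow> recursive b \<Longrightarrow> recursive c \<Longrightarrow>
    recursive (\<lambda>x. judge (t x) (a x) (b x) (c x))"
  unfolding judge_def by (intro recursive_basic)

lemma recursive_cons_code:
  "recursive a \<Longrightarrow> recursive b \<Longrightarrow> recursive (\<lambda>x. cons_code (a x) (b x))"
  unfolding cons_code_def by (intro recursive_basic)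

text \<open>The single parameter of a rule is read as a nested tuple of up to five
  metavariables.\<close>

definition arg0 :: "nat \<Rightarrow> nat" where "arg0 w = pfst w"
definition arg1 :: "nat \<Rightarrow> nat" where "arg1 w = pfst (psnd w)"
definition arg2 :: "nat \<Rightarrow> nat" where "arg2 w = pfst (psnd (psnd w))"
definition arg3 :: "nat \<Rightarrow> nat" where "arg3 w = pfst (psnd (psnd (psnd w)))"
definition arg4 :: "nat \<Rightarrow> nat" where "arg4 w = psnd (psnd (psnd (psnd w)))"

lemmas arg_defs = arg0_def arg1_def arg2_def arg3_def arg4_def

text \<open>The first seven rules mirror the clauses of \<open>rec_eval\<close> in order; then come
  two rules each for kinds 2, 3 and 1, which derive the premises of \<open>Mu\<close>,
  \<open>Proj\<close> and \<open>Comp\<close> step by step. In the successor rule of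
  \<open>PrimRec\<close>, \<open>arg0\<close> codes both subprograms at once, which keeps it within
  five metavariables.\<close>

definition eval_rules ::
    "((nat \<Rightarrow> nat) \<times> (nat \<Rightarrow> nat) \<times> (nat \<Rightarrow> nat)) list" where
  "eval_rules =
    [(\<lambda>w. 0, \<lambda>w. 0,
      \<lambda>w. judge 0 (prod_encode (0, 0)) (arg0 w) 0),
     (\<lambda>w. 0, \<lambda>w. 0,
      \<lambda>w. judge 0 (prod_encode (1, 0)) (cons_code (arg0 w) 0) (Suc (arg0 w))),
     (\<lambda>w. judge 3 (arg0 w) (arg1 w) (arg2 w), \<lambda>w. 0,
      \<lambda>w. judge 0 (prod_encode (2, arg0 w)) (arg1 w) (arg2 w)),
     (\<lambda>w. judge 1 (arg0 w) (arg1 w) (arg2 w), \<lambda>w. judge 0 (arg3 w) (arg2 w) (arg4 w),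
      \<lambda>w. judge 0 (prod_encode (3, prod_encode (arg3 w, arg0 w))) (arg1 w) (arg4 w)),
     (\<lambda>w. judge 0 (arg0 w) (arg1 w) (arg2 w), \<lambda>w. 0,
      \<lambda>w. judge 0 (prod_encode (4, prod_encode (arg0 w, arg3 w))) (cons_code 0 (arg1 w))
        (arg2 w)),
     (\<lambda>w. judge 0 (prod_encode (4, arg0 w)) (cons_code (arg1 w) (arg2 w)) (arg3 w),
      \<lambda>w. judge 0 (psnd (arg0 w)) (cons_code (arg1 w) (cons_code (arg3 w) (arg2 w))) (arg4 w),
      \<lambda>w. judge 0 (prod_encode (4, arg0 w)) (cons_code (Suc (arg1 w)) (arg2 w)) (arg4 w)),
     (\<lambda>w. judge 0 (arg0 w) (cons_code (arg1 w) (arg2 w)) 0,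
      \<lambda>w. judge 2 (arg0 w) (arg1 w) (arg2 w),
      \<lambda>w. judge 0 (prod_encode (5, arg0 w)) (arg2 w) (arg1 w)),
     (\<lambda>w. 0, \<lambda>w. 0,
      \<lambda>w. judge 2 (arg0 w) 0 (arg1 w)),
     (\<lambda>w. judge 2 (arg0 w) (arg1 w) (arg2 w),
      \<lambda>w. judge 0 (arg0 w) (cons_code (arg1 w) (arg2 w)) (Suc (arg3 w)),
      \<lambda>w. judge 2 (arg0 w) (Suc (arg1 w)) (arg2 w)),
     (\<lambda>w. 0, \<lambda>w. 0,
      \<lambda>w. judge 3 0 (cons_code (arg0 w) (arg1 w)) (arg0 w)),
     (\<lambda>w. judge 3 (arg0 w) (arg1 w) (arg2 w), \<lambda>w. 0,
      \<lambda>w. judge 3 (Suc (arg0 w)) (cons_code (arg3 w) (arg1 w)) (arg2 w)),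
     (\<lambda>w. 0, \<lambda>w. 0,
      \<lambda>w. judge 1 0 (arg0 w) 0),
     (\<lambda>w. judge 0 (arg0 w) (arg1 w) (arg2 w), \<lambda>w. judge 1 (arg3 w) (arg1 w) (arg4 w),
      \<lambda>w. judge 1 (cons_code (arg0 w) (arg3 w)) (arg1 w) (cons_code (arg2 w) (arg4 w)))]"

abbreviation derivable :: "nat set" where
  "derivable \<equiv> closure eval_rules"

lemma recursive_eval_rules:
  "(p, q, c) \<in> set eval_rules \<Longrightarrow> recursive p \<and> recursive q \<and> recursive c"
  unfolding eval_rules_def arg_defs
  by (auto intro!: recursive_judge recursive_cons_code recursive_basic)

lemma derivable_step:
  assumes "(p, q, c) \<in> set eval_rules"
    "p (prod_encode (a0, prod_encode (a1, prod_encode (a2, prod_encode (a3, a4))))) \<in> derivable"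
    "q (prod_encode (a0, prod_encode (a1, prod_encode (a2, prod_encode (a3, a4))))) \<in> derivable"
  shows "c (prod_encode (a0, prod_encode (a1, prod_encode (a2, prod_encode (a3, a4))))) \<in> derivable"
  using assms by (rule closure.step)

lemma eval_rules_nth_mem: "i < length eval_rules \<Longrightarrow> eval_rules ! i = (p, q, c) \<Longrightarrow>
    (p, q, c) \<in> set eval_rules"
  by (metis nth_mem)

lemmas derivable_rule = derivable_step[OF eval_rules_nth_mem]

section \<open>Adequacy: derivability agrees with evaluation\<close>

lemma derivable_Zero: "judge 0 (code Zero) xs 0 \<in> derivable"
  using derivable_rule[of 0 _ _ _ xs] by (simp add: eval_rules_def arg_defs closure.zero)

lemma derivable_Succ: "judge 0 (code Succ) (cons_code x 0) (Suc x) \<in> derivable"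
  using derivable_rule[of 1 _ _ _ x] by (simp add: eval_rules_def arg_defs closure.zero)

lemma derivable_Proj: "judge 3 i xs v \<in> derivable \<Longrightarrow> judge 0 (code (Proj i)) xs v \<in> derivable"
  using derivable_rule[of 2 _ _ _ i xs v] by (simp add: eval_rules_def arg_defs closure.zero)

lemma derivable_Comp:
  "judge 1 (list_encode (map code gs)) xs ys \<in> derivable \<Longrightarrow> judge 0 (code f) ys z \<in> derivable \<Longrightarrow>
    judge 0 (code (Comp f gs)) xs z \<in> derivable"
  using derivable_rule[of 3 _ _ _ "list_encode (map code gs)" xs ys "code f" z]
  by (simp add: eval_rules_def arg_defs)

lemma derivable_PrimRec_0:
  "judge 0 (code f) xs y \<in> derivable \<Longrightarrow>
    judge 0 (code (PrimRec f g)) (cons_code 0 xs) y \<in> derivable"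
  using derivable_rule[of 4 _ _ _ "code f" xs y "code g"]
  by (simp add: eval_rules_def arg_defs closure.zero)

lemma derivable_PrimRec_Suc:
  "judge 0 (code (PrimRec f g)) (cons_code n xs) y \<in> derivable \<Longrightarrow>
    judge 0 (code g) (cons_code n (cons_code y xs)) z \<in> derivable \<Longrightarrow>
    judge 0 (code (PrimRec f g)) (cons_code (Suc n) xs) z \<in> derivable"
  using derivable_rule[of 5 _ _ _ "prod_encode (code f, code g)" n xs y z]
  by (simp add: eval_rules_def arg_defs)

lemma derivable_Mu:
  "judge 0 (code f) (cons_code n xs) 0 \<in> derivable \<Longrightarrow> judge 2 (code f) n xs \<in> derivable \<Longrightarrow>
    judge 0 (code (Mu f)) xs n \<in> derivable"
  using derivable_rule[of 6 _ _ _ "code f" n xs] by (simp add: eval_rules_def arg_defs)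

lemma derivable_all_0: "judge 2 f 0 xs \<in> derivable"
  using derivable_rule[of 7 _ _ _ f xs] by (simp add: eval_rules_def arg_defs closure.zero)

lemma derivable_all_Suc:
  "judge 2 f n xs \<in> derivable \<Longrightarrow> judge 0 f (cons_code n xs) (Suc y) \<in> derivable \<Longrightarrow>
    judge 2 f (Suc n) xs \<in> derivable"
  using derivable_rule[of 8 _ _ _ f n xs y] by (simp add: eval_rules_def arg_defs)

lemma derivable_nth_0: "judge 3 0 (cons_code v xs) v \<in> derivable"
  using derivable_rule[of 9 _ _ _ v xs] by (simp add: eval_rules_def arg_defs closure.zero)

lemma derivable_nth_Suc:
  "judge 3 i xs v \<in> derivable \<Longrightarrow> judge 3 (Suc i) (cons_code y xs) v \<in> derivable"
  using derivable_rule[of 10 _ _ _ i xs v y] by (simp add: eval_rules_def arg_defs closure.zero)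

lemma derivable_Nil: "judge 1 0 xs 0 \<in> derivable"
  using derivable_rule[of 11 _ _ _ xs] by (simp add: eval_rules_def arg_defs closure.zero)

lemma derivable_Cons:
  "judge 0 g xs y \<in> derivable \<Longrightarrow> judge 1 gs xs ys \<in> derivable \<Longrightarrow>
    judge 1 (cons_code g gs) xs (cons_code y ys) \<in> derivable"
  using derivable_rule[of 12 _ _ _ g xs y gs ys] by (simp add: eval_rules_def arg_defs)

lemma derivable_nth_list: "i < length xs \<Longrightarrow> judge 3 i (list_encode xs) (xs ! i) \<in> derivable"
proof (induction xs arbitrary: i)
  case (Cons x xs)
  then show ?case
    by (cases i) (auto simp del: list_encode.simps simp: list_encode_Cons
        intro: derivable_nth_0 derivable_nth_Suc)
qed simp

lemma derivable_complete: "rec_eval p xs v \<Longrightarrow> judge 0 (code p) (list_encode xs) v \<in> derivable"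
proof (induction rule: rec_eval.induct)
  case (Zero xs)
  show ?case by (rule derivable_Zero)
next
  case (Succ x)
  show ?case using derivable_Succ[of x] by (simp add: cons_code_def)
next
  case (Proj i xs)
  then show ?case by (intro derivable_Proj derivable_nth_list)
next
  case (Comp xs gs ys f z)
  from Comp.IH(1) have "judge 1 (list_encode (map code gs)) (list_encode xs) (list_encode ys)
      \<in> derivable"
  proof (induction rule: list_all2_induct)
    case Nil
    show ?case using derivable_Nil by simp
  next
    case (Cons g gs y ys)
    then show ?case
      using derivable_Cons by (simp del: list_encode.simps add: list_encode_Cons)
  qed
  then show ?case by (rule derivable_Comp) (rule Comp.IH(2))
next
  case (PrimRec_0 f xs y g)
  then show ?case
    unfolding list_encode_Cons by (intro derivable_PrimRec_0)
next
  case (PrimRec_Suc f g n xs y z)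
  then show ?case
    unfolding list_encode_Cons by (intro derivable_PrimRec_Suc)
next
  case (Mu f n xs)
  \<comment> \<open>The bounded universal premise of \<open>Mu\<close> is built up one index at a
    time.\<close>
  have "judge 2 (code f) k (list_encode xs) \<in> derivable" if "k \<le> n" for k
    using that
  proof (induction k)
    case 0
    show ?case by (rule derivable_all_0)
  next
    case (Suc k)
    with Mu.IH(2) obtain y where "judge 0 (code f) (list_encode (k # xs)) (Suc y) \<in> derivable"
      using Suc_le_eq by blast
    with Suc show ?case
      unfolding list_encode_Cons by (auto intro: derivable_all_Suc)
  qed
  with Mu.IH(1) show ?case
    unfolding list_encode_Cons by (intro derivable_Mu) auto
qed

text \<open>Quantifying over the programs with the given codes makes judgements about numbers
  that code no program vacuously valid.\<close>

definition valid :: "nat \<Rightarrow> bool" where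
  "valid j \<longleftrightarrow>
    (\<forall>p xs v. j = judge 0 (code p) xs v \<longrightarrow> rec_eval p (list_decode xs) v) \<and>
    (\<forall>gs xs ys. j = judge 1 (list_encode (map code gs)) xs ys \<longrightarrow>
      list_all2 (\<lambda>g y. rec_eval g (list_decode xs) y) gs (list_decode ys)) \<and>
    (\<forall>f n xs. j = judge 2 (code f) n xs \<longrightarrow>
      (\<forall>i<n. \<exists>y. rec_eval f (i # list_decode xs) (Suc y))) \<and>
    (\<forall>i xs v. j = judge 3 i xs v \<longrightarrow> i < length (list_decode xs) \<and> list_decode xs ! i = v)"

lemma valid_0: "valid 0"
  by (simp add: valid_def)

lemma valid_judge:
  "valid (judge 0 a b c) \<longleftrightarrow> (\<forall>p. code p = a \<longrightarrow> rec_eval p (list_decode b) c)"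
  "valid (judge (Suc 0) a b c) \<longleftrightarrow> (\<forall>gs. list_encode (map code gs) = a \<longrightarrow>
      list_all2 (\<lambda>g y. rec_eval g (list_decode b) y) gs (list_decode c))"
  "valid (judge 2 a b c) \<longleftrightarrow> (\<forall>f. code f = a \<longrightarrow>
      (\<forall>i<b. \<exists>y. rec_eval f (i # list_decode c) (Suc y)))"
  "valid (judge 3 a b c) \<longleftrightarrow> a < length (list_decode b) \<and> list_decode b ! a = c"
  by (auto simp: valid_def)

text \<open>If the conclusion of a rule refers to coded programs, injectivity of the coding yields
  programs for its premises, to which their validity applies; the matching clause of
  \<open>rec_eval\<close> finishes.\<close>

lemma valid_step:
  assumes "(p, q, c) \<in> set eval_rules" "valid (p w)" "valid (q w)"
  shows "valid (c w)"
proof -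
  have Proj: "i < length xs \<Longrightarrow> xs ! i = v \<Longrightarrow> rec_eval (Proj i) xs v" for i xs v
    using rec_eval.Proj by blast
  show ?thesis
    using assms unfolding eval_rules_def
    apply (simp only: set_simps insert_iff empty_iff prod.inject)
    apply (elim disjE conjE)
                apply (simp_all add: valid_judge valid_0 code_eq_iff list_encode_eq_cons_code
        list_encode_eq_0 less_Suc_eq)
             apply (auto intro: rec_eval.Zero rec_eval.Succ Proj rec_eval.PrimRec_0 rec_eval.Mu)
     apply (blast intro: rec_eval.Comp rec_eval.PrimRec_Suc)+
    done
qed

lemma derivable_valid: "j \<in> derivable \<Longrightarrow> valid j"
  by (induction rule: closure.induct) (auto intro: valid_0 valid_step)

lemma rec_eval_iff_derivable:
  "rec_eval p xs v \<longleftrightarrow> judge 0 (code p) (list_encode xs) v \<in> derivable"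
proof
  assume "judge 0 (code p) (list_encode xs) v \<in> derivable"
  then have "\<forall>p'. code p' = code p \<longrightarrow> rec_eval p' (list_decode (list_encode xs)) v"
    using derivable_valid valid_judge(1) by blast
  then show "rec_eval p xs v" by simp
qed (rule derivable_complete)

section \<open>An enumeration of the \<open>\<Sigma>\<^sup>0\<^sub>1\<close> sets\<close>

text \<open>Stage \<open>n\<close> in the enumeration of the \<open>k\<close>-th set: bounding both
  the witness \<open>y\<close> and the derivation by \<open>n\<close> makes it decidable and
  monotone in \<open>n\<close>. Every number serves as an index; what matters is that each set in
  \<open>Sigma01\<close> has one.\<close>

definition enum :: "nat \<Rightarrow> nat \<Rightarrow> nat \<Rightarrow> bool" where
  "enum k n z \<longleftrightarrow>
    (\<exists>y<n. judge 0 k (cons_code z (cons_code y 0)) 1 \<in> set_decode (stage eval_rules n))"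

lemma enum_mono: "enum k m z \<Longrightarrow> m \<le> n \<Longrightarrow> enum k n z"
  unfolding enum_def using stage_mono[of m n eval_rules] by (meson in_mono less_le_trans)

lemma decidable_enum:
  assumes "recursive a" "recursive b" "recursive c"
  shows "decidable (\<lambda>x. enum (a x) (b x) (c x))"
proof -
  note compose = assms[THEN recursive_compose]
  show ?thesis
    unfolding enum_def
    by (intro recursive_intros recursive_judge recursive_cons_code assms compose recursive_stage
        recursive_eval_rules)
qed

lemma Sigma01_enum:
  assumes "A \<in> Sigma01"
  shows "\<exists>k. \<forall>z. z \<in> A \<longleftrightarrow> (\<exists>n. enum k n z)"
proof -
  obtain R p where p: "\<And>xs. length xs = 2 \<Longrightarrow> rec_eval p xs (if xs \<in> R then 1 else 0)"
    and A: "A = {x. \<exists>y. [x, y] \<in> R}"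
    using assms unfolding Sigma01_def computable_rel_def by blast
  \<comment> \<open>The program also halts with 0 off \<open>R\<close>; determinism keeps the two
    values apart.\<close>
  have R: "[z, y] \<in> R \<longleftrightarrow> judge 0 (code p) (cons_code z (cons_code y 0)) 1 \<in> derivable" for z y
  proof -
    have "[z, y] \<in> R \<longleftrightarrow> rec_eval p [z, y] 1"
      using p[of "[z, y]"] rec_eval_deterministic[of p "[z, y]"] by (fastforce split: if_splits)
    then show ?thesis
      by (simp add: rec_eval_iff_derivable cons_code_def)
  qed
  have "z \<in> A \<longleftrightarrow> (\<exists>n. enum (code p) n z)" for z
  proof
    assume "z \<in> A"
    then obtain y n where n: "judge 0 (code p) (cons_code z (cons_code y 0)) 1
        \<in> set_decode (stage eval_rules n)"
      unfolding A mem_Collect_eq R closure_iff_stage by blast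
    then have "judge 0 (code p) (cons_code z (cons_code y 0)) 1
        \<in> set_decode (stage eval_rules (max n (Suc y)))"
      using stage_mono[of n "max n (Suc y)"] by auto
    then have "enum (code p) (max n (Suc y)) z"
      unfolding enum_def by (intro exI[of _ y]) simp
    then show "\<exists>n. enum (code p) n z" ..
  next
    assume "\<exists>n. enum (code p) n z"
    then show "z \<in> A"
      unfolding A mem_Collect_eq R closure_iff_stage enum_def by blast
  qed
  then show ?thesis by blast
qed

section \<open>Row sizes, approximated from below\<close>

text \<open>The class of \<open>x\<close> if \<open>k\<close> enumerates an equivalence relation.
  The construction treats all indices alike, since being an equivalence relation cannot be checked
  along the way.\<close>

definition section_of :: "nat \<Rightarrow> nat \<Rightarrow> nat set" where
  "section_of k x = {y. \<exists>n. enum k n (prod_encode (x, y))}"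

definition count :: "nat \<Rightarrow> nat \<Rightarrow> nat \<Rightarrow> nat" where
  "count k x s = (\<Sum>y<s. of_bool (enum k s (prod_encode (x, y))))"

lemma recursive_count:
  assumes "recursive a" "recursive b" "recursive c"
  shows "recursive (\<lambda>x. count (a x) (b x) (c x))"
proof -
  note compose = assms[THEN recursive_compose]
  show ?thesis
    unfolding count_def
    by (intro recursive_sum decidable_enum[unfolded decidable_def] recursive_basic assms compose)
qed

text \<open>\<open>count\<close> measures finite subsets of the row, and monotonicity of
  \<open>enum\<close> puts every finite subset of the row inside one of them. Infinite rows get
  their own disjunct because \<open>card\<close> is 0 there.\<close>

lemma count_ge_iff:
  "(\<exists>s. c \<le> count k x s) \<longleftrightarrow> (infinite (section_of k x) \<or> c \<le> card (section_of k x))"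
proof -
  define A where "A s = {..<s} \<inter> {y. enum k s (prod_encode (x, y))}" for s
  have count: "count k x s = card (A s)" for s
    by (simp add: count_def A_def)
  have A_sub: "A s \<subseteq> section_of k x" and A_fin: "finite (A s)" for s
    by (auto simp: A_def section_of_def)
  have A_ex: "\<exists>s. F \<subseteq> A s" if "finite F" "F \<subseteq> section_of k x" for F
    using that
  proof (induction F rule: finite_induct)
    case (insert y F)
    then obtain s where s: "F \<subseteq> A s" by auto
    from insert.prems obtain n where n: "enum k n (prod_encode (x, y))"
      by (auto simp: section_of_def)
    have "insert y F \<subseteq> A (max s (max n (Suc y)))"
      using s n by (auto simp: A_def intro: enum_mono)
    then show ?case by blast
  qed simp
  show ?thesis
  proof
    assume "\<exists>s. c \<le> count k x s"
    then obtain s where "c \<le> card (A s)" by (auto simp: count)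
    then show "infinite (section_of k x) \<or> c \<le> card (section_of k x)"
      using card_mono[OF _ A_sub] by (meson le_trans)
  next
    assume "infinite (section_of k x) \<or> c \<le> card (section_of k x)"
    then obtain F where F: "finite F" "F \<subseteq> section_of k x" "card F = c"
      by (metis infinite_arbitrarily_large obtain_subset_with_card_n)
    with A_ex obtain s where "F \<subseteq> A s" by blast
    with F A_fin have "c \<le> card (A s)" by (metis card_mono)
    then show "\<exists>s. c \<le> count k x s" by (auto simp: count)
  qed
qed

section \<open>The diagonal structure\<close>

text \<open>\<open>m\<close> codes a row and a stage at which the row may have reached size
  \<open>k + 2\<close>; \<open>t\<close> is the time of the confirmation. One number for both makes
  the condition on \<open>k\<close> a single for-all-exists.\<close>

definition fires :: "nat \<Rightarrow> nat \<Rightarrow> nat \<Rightarrow> bool" where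
  "fires k m t \<longleftrightarrow> (k + 2 \<le> count k (pfst m) (psnd m) \<longrightarrow> k + 3 \<le> count k (pfst m) t)"

lemma decidable_fires:
  assumes "recursive a" "recursive b" "recursive c"
  shows "decidable (\<lambda>x. fires (a x) (b x) (c x))"
  unfolding fires_def by (intro recursive_intros recursive_count assms)

text \<open>A row of size exactly \<open>k + 2\<close> reaches that count at some stage
  \<open>s\<close> and never \<open>k + 3\<close>, so the pair of the row and \<open>s\<close> never
  fires. Infinite rows have \<open>card\<close> 0 and pass every threshold.\<close>

lemma fires_iff:
  "(\<forall>m. \<exists>t. fires k m t) \<longleftrightarrow> (\<forall>x. card (section_of k x) \<noteq> k + 2)"
proof
  assume fires: "\<forall>m. \<exists>t. fires k m t"
  show "\<forall>x. card (section_of k x) \<noteq> k + 2"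
  proof (intro allI notI)
    fix x assume card: "card (section_of k x) = k + 2"
    then have fin: "finite (section_of k x)"
      by (intro card_ge_0_finite) simp
    from card count_ge_iff[of "k + 2" k x] obtain s where "k + 2 \<le> count k x s"
      by auto
    with fires[rule_format, of "prod_encode (x, s)"] have "\<exists>t. k + 3 \<le> count k x t"
      by (auto simp: fires_def)
    with fin card show False
      unfolding count_ge_iff by simp
  qed
next
  assume card: "\<forall>x. card (section_of k x) \<noteq> k + 2"
  show "\<forall>m. \<exists>t. fires k m t"
  proof
    fix m
    show "\<exists>t. fires k m t"
    proof (cases "k + 2 \<le> count k (pfst m) (psnd m)")
      case True
      then have "infinite (section_of k (pfst m)) \<or> k + 2 \<le> card (section_of k (pfst m))"
        using count_ge_iff by blast
      with card[rule_format, of "pfst m"] have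
        "infinite (section_of k (pfst m)) \<or> k + 3 \<le> card (section_of k (pfst m))"
        by linarith
      then show ?thesis
        unfolding fires_def using count_ge_iff by blast
    qed (simp add: fires_def)
  qed
qed

text \<open>Element \<open>i\<close> of chunk \<open>k\<close> has code \<open>prod_encode (k, i)\<close>. The first \<open>k + 2\<close> elements of
  a chunk stay equivalent forever; the element \<open>k + 2 + j\<close> is expelled and becomes a singleton
  class once every \<open>m \<le> j\<close> has fired.\<close>

definition retained :: "nat \<Rightarrow> nat \<Rightarrow> bool" where
  "retained x u \<longleftrightarrow> psnd x < pfst x + 2 \<or>
    \<not> (\<forall>m < psnd x - pfst x - 1. \<exists>t<u. fires (pfst x) m t)"

definition core :: "nat set" where
  "core = {x. \<forall>u. retained x u}"

definition diag_rel :: "(nat \<times> nat) set" where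
  "diag_rel = {(x, y). x = y \<or> pfst x = pfst y \<and> x \<in> core \<and> y \<in> core}"

lemma decidable_retained:
  assumes "recursive a" "recursive b"
  shows "decidable (\<lambda>x. retained (a x) (b x))"
proof -
  note compose = assms[THEN recursive_compose]
  show ?thesis
    unfolding retained_def by (intro recursive_intros decidable_fires assms compose)
qed

text \<open>Finitely many firing times have a common bound \<open>u\<close>, so an element survives
  all \<open>u\<close> iff one fixed \<open>m\<close> never fires. For \<open>i = k + 2 + j\<close>
  the bound \<open>i - k - 1\<close> is \<open>j + 1\<close>, that is, \<open>m\<close> ranges up to
  \<open>j\<close>.\<close>

lemma core_iff:
  "prod_encode (k, i) \<in> core \<longleftrightarrow> i < k + 2 \<or> (\<exists>m. m < i - k - 1 \<and> (\<forall>t. \<not> fires k m t))"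
  (is "?L \<longleftrightarrow> ?R")
proof
  assume L: ?L
  show ?R
  proof (rule ccontr)
    assume not: "\<not> ?R"
    then have "\<forall>m. \<exists>t. m < i - k - 1 \<longrightarrow> fires k m t" by blast
    then obtain f where f: "\<And>m. m < i - k - 1 \<Longrightarrow> fires k m (f m)" by metis
    define u where "u = Suc (Max (f ` {..<i - k - 1}))"
    have "f m < u" if "m < i - k - 1" for m
      using that unfolding u_def by (intro le_imp_less_Suc Max_ge) auto
    with f have "\<forall>m<i - k - 1. \<exists>t<u. fires k m t" by blast
    with not have "\<not> retained (prod_encode (k, i)) u"
      by (simp add: retained_def)
    with L show False by (simp add: core_def)
  qed
qed (auto simp: core_def retained_def)

section \<open>Complexity and class sizes of the diagonal structure\<close>

lemma diag_rel_EQ: "diag_rel \<in> EQ"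
  unfolding EQ_def diag_rel_def
  by (auto simp: equiv_def refl_on_def sym_def trans_def)

text \<open>Only the two \<open>retained\<close> conditions depend on \<open>u\<close>, and a
  universal quantifier distributes over their conjunction; so one \<open>u\<close> serves both
  elements.\<close>

lemma diag_rel_Pi01: "prod_encode ` diag_rel \<in> Pi01"
proof -
  define P where "P z u \<longleftrightarrow> pfst z = psnd z \<or>
    pfst (pfst z) = pfst (psnd z) \<and> retained (pfst z) u \<and> retained (psnd z) u" for z u
  have "decidable (\<lambda>e. P (pfst e) (psnd e))"
    unfolding P_def by (intro recursive_intros decidable_retained)
  moreover have "[pfst e, psnd e] \<in> {[z, u] | z u. P z u} \<longleftrightarrow> P (pfst e) (psnd e)" for e
    by auto
  ultimately have "computable_rel 2 {[z, u] | z u. P z u}"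
    by (intro computable_rel_decidable) simp
  moreover have "prod_encode ` diag_rel = {z. \<forall>u. [z, u] \<in> {[z, u] | z u. P z u}}"
  proof -
    have "z \<in> prod_encode ` diag_rel \<longleftrightarrow> (pfst z, psnd z) \<in> diag_rel" for z
      by (metis (no_types, lifting) image_iff inj_image_mem_iff inj_prod_encode
          prod_encode_pfst_psnd)
    then show ?thesis
      by (auto simp: diag_rel_def core_def P_def)
  qed
  ultimately show ?thesis unfolding Pi01_def by blast
qed

text \<open>The core of chunk \<open>k\<close> is \<open>{..<k + 2}\<close> if the condition holds
  for \<open>k\<close>, and infinite otherwise; all other classes are singletons. So a finite class
  of size \<open>k + 2\<close> can only come from chunk \<open>k\<close> itself.\<close>

lemma diag_rel_class_card:
  "(\<exists>x. card (diag_rel `` {x}) = k + 2) \<longleftrightarrow> (\<forall>m. \<exists>t. fires k m t)"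
proof -
  have cls: "diag_rel `` {prod_encode (k, i)} =
      (\<lambda>i. prod_encode (k, i)) ` {i. prod_encode (k, i) \<in> core}"
    if "prod_encode (k, i) \<in> core" for k i
  proof -
    have "y \<in> diag_rel `` {prod_encode (k, i)} \<longleftrightarrow>
        y \<in> (\<lambda>i. prod_encode (k, i)) ` {i. prod_encode (k, i) \<in> core}" for y
    proof -
      obtain a b where y: "y = prod_encode (a, b)"
        using prod_encode_pfst_psnd[of y] by metis
      show ?thesis
        using that by (auto simp: y diag_rel_def)
    qed
    then show ?thesis by blast
  qed
  have card: "card (diag_rel `` {prod_encode (k, i)}) = card {i. prod_encode (k, i) \<in> core}"
    if "prod_encode (k, i) \<in> core" for k i
    unfolding cls[OF that] by (intro card_image inj_onI) simp
  have core_fires: "card {i. prod_encode (k, i) \<in> core} = k + 2" if "\<forall>m. \<exists>t. fires k m t" for k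
  proof -
    have "{i. prod_encode (k, i) \<in> core} = {..<k + 2}"
      using that by (auto simp: core_iff)
    then show ?thesis by simp
  qed
  have core_inf: "infinite {i. prod_encode (k, i) \<in> core}" if "\<not> (\<forall>m. \<exists>t. fires k m t)" for k
  proof -
    from that obtain m where "\<forall>t. \<not> fires k m t" by blast
    \<comment> \<open>Expelling element \<open>k + 2 + j\<close> with \<open>j \<ge> m\<close> would
      require this \<open>m\<close> to fire.\<close>
    then have "{m + k + 2..} \<subseteq> {i. prod_encode (k, i) \<in> core}"
      by (auto simp: core_iff intro!: exI[of _ m])
    then show ?thesis using infinite_Ici infinite_super by blast
  qed
  show ?thesis
  proof
    assume "\<forall>m. \<exists>t. fires k m t"
    then show "\<exists>x. card (diag_rel `` {x}) = k + 2"
      using card[of k 0] core_fires[of k] by (auto simp: core_iff)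
  next
    assume "\<exists>x. card (diag_rel `` {x}) = k + 2"
    then obtain k' i where x: "card (diag_rel `` {prod_encode (k', i)}) = k + 2"
      by (metis prod_encode_pfst_psnd)
    have in_core: "prod_encode (k', i) \<in> core"
    proof (rule ccontr)
      assume "prod_encode (k', i) \<notin> core"
      then have "diag_rel `` {prod_encode (k', i)} = {prod_encode (k', i)}"
        by (auto simp: diag_rel_def)
      with x show False by simp
    qed
    with x card have *: "card {i. prod_encode (k', i) \<in> core} = k + 2" by metis
    then have fires: "\<forall>m. \<exists>t. fires k' m t"
      \<comment> \<open>An infinite core would have \<open>card\<close> 0 instead of
        \<open>k + 2\<close>.\<close>
      using core_inf[of k'] by (metis card.infinite add_2_eq_Suc' nat.distinct(1))
    with * core_fires[of k'] have "k' = k" by simp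
    with fires show "\<forall>m. \<exists>t. fires k m t" by simp
  qed
qed

section \<open>Diagonalization against isomorphic copies\<close>

text \<open>An isomorphism \<open>f\<close> maps the class of \<open>x\<close> bijectively onto the
  class of \<open>f x\<close>.\<close>

lemma isomorphic_class_card:
  assumes "isomorphic R S"
  shows "(\<exists>x. card (R `` {x}) = c) \<longleftrightarrow> (\<exists>x. card (S `` {x}) = c)"
proof -
  obtain f where f: "bij f" "\<And>x y. (x, y) \<in> R \<longleftrightarrow> (f x, f y) \<in> S"
    using assms unfolding isomorphic_def by blast
  have surj: "\<exists>x. f x = y" for y
    using f(1) by (metis bij_pointE)
  have "S `` {f x} = f ` (R `` {x})" for x
  proof (intro set_eqI iffI)
    fix y
    assume y: "y \<in> S `` {f x}"
    obtain z where z: "f z = y" using surj by blast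
    then have "z \<in> R `` {x}" using y f(2) by simp
    with z show "y \<in> f ` (R `` {x})" by blast
  qed (use f(2) in auto)
  then have card: "card (S `` {f x}) = card (R `` {x})" for x
    using card_image[OF inj_on_subset[OF bij_is_inj[OF f(1)] subset_UNIV]] by simp
  show ?thesis
  proof
    assume "\<exists>y. card (S `` {y}) = c"
    then obtain y where "card (S `` {y}) = c" by blast
    moreover obtain x where "f x = y" using surj by blast
    ultimately show "\<exists>x. card (R `` {x}) = c" using card[of x] by auto
  qed (use card in blast)
qed

text \<open>At an index \<open>k\<close> of \<open>S\<close> itself, \<open>diag_rel\<close> has a
  class of size \<open>k + 2\<close> iff \<open>S\<close> has none, whereas isomorphic structures
  have the same class sizes.\<close>

lemma diag_rel_not_isomorphic:
  assumes "S \<in> EQ_in Sigma01"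
  shows "\<not> isomorphic diag_rel S"
proof
  assume iso: "isomorphic diag_rel S"
  obtain k where k: "\<And>z. z \<in> prod_encode ` S \<longleftrightarrow> (\<exists>n. enum k n z)"
    using assms Sigma01_enum unfolding EQ_in_def by blast
  have "S `` {x} = section_of k x" for x
    by (auto simp: section_of_def k[symmetric] inj_image_mem_iff inj_prod_encode)
  then have "(\<exists>x. card (diag_rel `` {x}) = k + 2) \<longleftrightarrow> (\<exists>x. card (section_of k x) = k + 2)"
    using isomorphic_class_card[OF iso] by simp
  then show False
    unfolding diag_rel_class_card fires_iff by blast
qed

theorem theorem2p1:
  shows "(\<exists>R \<in> EQ_in Pi01. \<forall>S \<in> EQ_in Sigma01. \<not> isomorphic R S) \<and>
    \<not> IsoType Pi01 \<subseteq> IsoType Sigma01"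
proof
  have diag: "diag_rel \<in> EQ_in Pi01"
    using diag_rel_EQ diag_rel_Pi01 by (simp add: EQ_in_def)
  then show "\<exists>R \<in> EQ_in Pi01. \<forall>S \<in> EQ_in Sigma01. \<not> isomorphic R S"
    using diag_rel_not_isomorphic by blast
  show "\<not> IsoType Pi01 \<subseteq> IsoType Sigma01"
  proof
    assume "IsoType Pi01 \<subseteq> IsoType Sigma01"
    with diag obtain S where S: "S \<in> EQ_in Sigma01" "iso_type diag_rel = iso_type S"
      unfolding IsoType_def by blast
    \<comment> \<open>By the identity map \<open>S\<close> lies in its own type, hence in the equal
      type of \<open>diag_rel\<close>.\<close>
    have "isomorphic S S"
      unfolding isomorphic_def by (intro exI[of _ id]) simp
    with S have "S \<in> iso_type diag_rel"
      by (simp add: iso_type_def EQ_in_def)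
    then have "isomorphic diag_rel S"
      by (simp add: iso_type_def)
    with S(1) diag_rel_not_isomorphic show False by blast
  qed
qed

end
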